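(* Let $G=(N,E)$ be a simple hypergraph on $N=[n]$, let $\mathcal{F}_{\mathcal{A}_G}=\{I\mid H_I\in\mathcal{A}_G\}$ be the building set of its connected hypersubgraph arrangement $\mathcal{A}_G$, and let $\mathfrak{n}$ be a nested set of $\mathcal{F}_{\mathcal{A}_G}$ with $|\mathfrak{n}|=k$. Then the intersection $$X_{\mathfrak{n}}=\bigcap_{I\in\mathfrak{n}}H_I$$ has rank $k$ in $L(\mathcal{A}_G)$ (i.e. full rank).
   Context: A simple hypergraph $G=(N,E)$ has vertex set $N=[n]=\{1,\dots,n\}$ ($n\ge 1$) and edge set $E\subseteq 2^N$. For $\emptyset\neq I\subseteq N$ the induced hypersubgraph is $G[I]=(I,\{e\in E\mid e\subseteq I\})$. Two vertices $u,v$ are adjacent via $e\in E$ if $\{u,v\}\subseteq e$. A $(u,v)$-walk of length $k\geq 0$ is a sequence $v_1e_1v_2e_2\dots e_kv_{k+1}$ with $v_1=u$, $v_{k+1}=v$, $e_i\in E$, and $v_i,v_{i+1}$ adjacent via $e_i$; it is a path if all its vertices and all its edges are distinct. $G$ is connected if for all $u,v\in N$ there is a $(u,v)$-path (a one-vertex hypergraph is connected). For $\emptyset\ne I\subseteq N$ let $H_I=\ker\sum_{i\in I}x_i\subset\mathbb{Q}^n$. The connected hypersubgraph arrangement is $\mathcal{A}_G=\{H_I\mid \emptyset\neq I\subseteq N,\ G[I]\text{ is connected}\}$. The set $\mathcal{F}_{\mathcal{A}_G}$ is a Boolean building set on $[n]$: a family of nonempty subsets containing all singletons and closed under unions of intersecting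 pairs of members. A nested set $\mathfrak{n}$ of a building set $\mathcal{F}$ is a collection of (nonempty) members of $\mathcal{F}$ such that: (i) for any $n_1,n_2\in\mathfrak{n}$, either $n_1\subseteq n_2$, $n_1\supseteq n_2$, or $n_1\cap n_2=\emptyset$; (ii) for any collection of $k\ge 2$ pairwise disjoint $n_1,\dots,n_k\in\mathfrak{n}$, the union $n_1\cup\dots\cup n_k$ is not in $\mathcal{F}$; (iii) $\mathfrak{n}$ contains all inclusion-wise maximal elements of $\mathcal{F}$. $L(\mathcal{A})$ is the lattice of all intersections of hyperplanes in $\mathcal{A}$, and the rank of $X\in L(\mathcal{A})$ is its codimension in $V=\mathbb{Q}^n$. *)

theory Defs
  imports "HOL-Analysis.Cartesian_Space"
begin

text \<open>
  A hypergraph is a pair of a vertex set and a set of edges; as the edges form a set, there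
  are no multiple edges. The empty set and singletons are allowed as edges.
\<close>

type_synonym 'v hypergraph = "'v set \<times> 'v set set"

abbreviation verts :: "'v hypergraph \<Rightarrow> 'v set"
  where "verts G \<equiv> fst G"

abbreviation edges :: "'v hypergraph \<Rightarrow> 'v set set"
  where "edges G \<equiv> snd G"

definition simple_hypergraph :: "'v hypergraph \<Rightarrow> bool"
  where "simple_hypergraph G \<longleftrightarrow> finite (verts G) \<and> verts G \<noteq> {} \<and> edges G \<subseteq> Pow (verts G)"

definition induced :: "'v hypergraph \<Rightarrow> 'v set \<Rightarrow> 'v hypergraph"
  where "induced G I = (I, {e \<in> edges G. e \<subseteq> I})"

text \<open>
  The walk \<open>v\<^sub>1 e\<^sub>1 v\<^sub>2 \<dots> e\<^sub>k v\<^sub>k\<^sub>+\<^sub>1\<close> is given by the list \<open>vs\<close> of its \<open>k + 1\<close> vertices and the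
  list \<open>es\<close> of its \<open>k\<close> edges.
\<close>

definition is_walk :: "'v hypergraph \<Rightarrow> 'v \<Rightarrow> 'v list \<Rightarrow> 'v set list \<Rightarrow> 'v \<Rightarrow> bool"
  where "is_walk G u vs es v \<longleftrightarrow>
    length vs = length es + 1 \<and> set vs \<subseteq> verts G \<and> set es \<subseteq> edges G \<and>
    hd vs = u \<and> last vs = v \<and>
    (\<forall>i<length es. {vs ! i, vs ! (i + 1)} \<subseteq> es ! i)"

definition is_path :: "'v hypergraph \<Rightarrow> 'v \<Rightarrow> 'v list \<Rightarrow> 'v set list \<Rightarrow> 'v \<Rightarrow> bool"
  where "is_path G u vs es v \<longleftrightarrow> is_walk G u vs es v \<and> distinct vs \<and> distinct es"

definition hconnected :: "'v hypergraph \<Rightarrow> bool"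
  where "hconnected G \<longleftrightarrow> (\<forall>u\<in>verts G. \<forall>v\<in>verts G. \<exists>vs es. is_path G u vs es v)"

text \<open>
  The ambient space \<open>\<rat>\<^sup>n\<close> is \<^typ>\<open>rat ^ 'n\<close>, with the finite type \<open>'n\<close> in the role of \<open>[n]\<close>.
\<close>

definition hyp :: "'n::finite set \<Rightarrow> (rat ^ 'n) set"
  where "hyp I = {x. (\<Sum>i\<in>I. x $ i) = 0}"

definition conn_arrangement :: "'n::finite hypergraph \<Rightarrow> (rat ^ 'n) set set"
  where "conn_arrangement G =
    {hyp I | I. I \<noteq> {} \<and> I \<subseteq> verts G \<and> hconnected (induced G I)}"

definition building_set_of :: "(rat ^ 'n::finite) set set \<Rightarrow> 'n set set"
  where "building_set_of A = {I. I \<noteq> {} \<and> hyp I \<in> A}"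

text \<open>
  As the members of a nested set are nonempty, pairwise disjoint members
  \<open>n\<^sub>1, \<dots>, n\<^sub>k\<close> are distinct, so such a collection is a subset \<open>M\<close> with \<open>k\<close> elements.
\<close>

definition nested_set :: "'a set set \<Rightarrow> 'a set set \<Rightarrow> bool"
  where "nested_set F S \<longleftrightarrow>
    S \<subseteq> F \<and>
    (\<forall>I\<in>S. \<forall>J\<in>S. I \<subseteq> J \<or> J \<subseteq> I \<or> I \<inter> J = {}) \<and>
    (\<forall>M\<subseteq>S. finite M \<and> card M \<ge> 2 \<and> pairwise disjnt M \<longrightarrow> \<Union>M \<notin> F) \<and>
    (\<forall>I\<in>F. (\<forall>J\<in>F. I \<subseteq> J \<longrightarrow> J = I) \<longrightarrow> I \<in> S)"

text \<open>
  The intersection of the empty family is \<^term>\<open>UNIV\<close>, i.e. the whole space.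
\<close>

definition intersection_lattice :: "(rat ^ 'n::finite) set set \<Rightarrow> (rat ^ 'n) set set"
  where "intersection_lattice A = {\<Inter>B | B. B \<subseteq> A}"

definition lattice_rank :: "(rat ^ 'n::finite) set \<Rightarrow> nat"
  where "lattice_rank X = CARD('n) - vec.dim X"

end

theory Submission
  imports Defs
begin

text \<open>
  The equations \<open>\<Sum>i\<in>I. x $ i = 0\<close> for \<open>I\<close> in a nested set \<open>S\<close> are triangular after a suitable
  choice of pivots. The maximal members of \<open>S\<close> strictly inside \<open>I \<in> S\<close> are pairwise disjoint, so
  their union is not \<open>I\<close>: with two or more of them the union lies outside the building set, to
  which \<open>I\<close> belongs, and with at most one it is a proper subset of \<open>I\<close>. Hence \<open>I\<close> has a private
  element \<open>r I\<close>, one that lies in no member of \<open>S\<close> strictly inside \<open>I\<close>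
  (\<open>nested_set_private_element\<close>). Replacing for each \<open>I \<in> S\<close> the coordinate \<open>r I\<close> by the sum over
  \<open>I\<close> is then an invertible change of coordinates, as the old coordinates are recovered by going up
  the inclusion order, and it maps \<open>\<Inter>I\<in>S. hyp I\<close> onto the coordinate subspace on which the
  \<open>card S\<close> pivot coordinates vanish
  (\<open>dim_Inter_hyp_laminar\<close>). So the intersection has codimension \<open>card S\<close>.
\<close>

text \<open>
  If the smaller members of \<open>S\<close> covered \<open>I\<close>, then so would the maximal ones among them. These are
  pairwise disjoint, so \<open>I \<in> F\<close> would be a forbidden union of a disjoint family, unless a single
  proper subset of \<open>I\<close> covered it.
\<close>

lemma nested_set_private_element:
  fixes S :: "'a set set"
  assumes nested: "nested_set F S" and fin: "finite S" and nonempty: "{} \<notin> F" and I: "I \<in> S"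
  shows "\<exists>i\<in>I. \<forall>J\<in>S. J \<subset> I \<longrightarrow> i \<notin> J"
proof (rule ccontr)
  have "S \<subseteq> F"
    and laminar: "\<forall>I\<in>S. \<forall>J\<in>S. I \<subseteq> J \<or> J \<subseteq> I \<or> I \<inter> J = {}"
    and union_notin: "\<forall>M\<subseteq>S. finite M \<and> card M \<ge> 2 \<and> pairwise disjnt M \<longrightarrow> \<Union>M \<notin> F"
    using nested unfolding nested_set_def by - (elim conjE, assumption)+
  assume "\<not> ?thesis"
  then have cover: "\<exists>J\<in>S. J \<subset> I \<and> i \<in> J" if "i \<in> I" for i
    using that by blast
  define below where "below = {J \<in> S. J \<subset> I}"
  define M where "M = {J \<in> below. \<forall>K\<in>below. J \<subseteq> K \<longrightarrow> K = J}"
  have fin_below: "finite below" and M_below: "M \<subseteq> below" and M_S: "M \<subseteq> S"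
    using fin by (auto simp: below_def M_def)
  then have fin_M: "finite M"
    using finite_subset by blast
  have disj: "pairwise disjnt M"
  proof (rule pairwiseI)
    fix J K assume JK: "J \<in> M" "K \<in> M" "J \<noteq> K"
    then have "J \<subseteq> K \<or> K \<subseteq> J \<or> J \<inter> K = {}"
      using laminar M_S by (meson subsetD)
    moreover have "\<not> J \<subseteq> K" "\<not> K \<subseteq> J"
      using JK by (auto simp: M_def)
    ultimately show "disjnt J K"
      by (simp add: disjnt_def)
  qed
  have union: "\<Union>M = I"
  proof
    show "\<Union>M \<subseteq> I"
      by (auto simp: M_def below_def)
    show "I \<subseteq> \<Union>M"
    proof
      fix i assume "i \<in> I"
      then obtain J where J: "J \<in> below" "i \<in> J"
        using cover by (auto simp: below_def)
      obtain K where "K \<in> below" "J \<subseteq> K" "\<forall>L\<in>below. K \<subseteq> L \<longrightarrow> K = L"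
        using finite_has_maximal2[OF fin_below J(1)] by metis
      then have "K \<in> M"
        unfolding M_def by blast
      with \<open>J \<subseteq> K\<close> \<open>i \<in> J\<close> show "i \<in> \<Union>M" by blast
    qed
  qed
  have "I \<in> F" and "I \<noteq> {}"
    using \<open>S \<subseteq> F\<close> I nonempty by auto
  then have "\<not> card M \<ge> 2"
    using union_notin M_S fin_M disj union by metis
  moreover have "card M \<noteq> 0"
    using union \<open>I \<noteq> {}\<close> fin_M by auto
  ultimately have "card M = 1" by linarith
  then obtain J where "M = {J}"
    by (auto simp: card_1_singleton_iff)
  then have "J = I" "J \<in> below"
    using union M_below by auto
  then show False
    by (simp add: below_def)
qed

text \<open>
  A pivot \<open>r J\<close> that lies in \<open>I\<close> belongs to a \<open>J \<subseteq> I\<close>. So apart from \<open>x $ r I\<close> the sum over \<open>I\<close>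
  only involves non-pivot coordinates and pivots of smaller members of \<open>S\<close>; solving from the
  inside out determines each pivot coordinate from the sums and the remaining coordinates.
\<close>

lemma dim_Inter_hyp_laminar:
  fixes S :: "'n::finite set set" and r :: "'n set \<Rightarrow> 'n"
  assumes laminar: "\<And>I J. I \<in> S \<Longrightarrow> J \<in> S \<Longrightarrow> I \<subseteq> J \<or> J \<subseteq> I \<or> I \<inter> J = {}"
    and r_in: "\<And>I. I \<in> S \<Longrightarrow> r I \<in> I"
    and r_private: "\<And>I J. I \<in> S \<Longrightarrow> J \<in> S \<Longrightarrow> J \<subset> I \<Longrightarrow> r I \<notin> J"
  shows "vec.dim (\<Inter>I\<in>S. hyp I) + card S = CARD('n)"
proof -
  have below: "J \<subseteq> I" if "I \<in> S" "J \<in> S" "r J \<in> I" for I J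
    using laminar[OF that(1,2)] r_in[OF that(2)] r_private[OF that(2,1)] that(3) by blast
  have inj_r: "inj_on r S"
  proof (rule inj_onI)
    fix I J assume IJ: "I \<in> S" "J \<in> S" "r I = r J"
    have "r J \<in> I" "r I \<in> J"
      using r_in[OF IJ(1)] r_in[OF IJ(2)] unfolding IJ(3) .
    then show "I = J"
      by (intro subset_antisym below IJ)
  qed
  \<comment> \<open>The change of coordinates: each pivot coordinate gives way to the sum it is the pivot of.\<close>
  define f :: "rat ^ 'n \<Rightarrow> rat ^ 'n" where
    "f x = (\<chi> j. if j \<in> r ` S then \<Sum>i\<in>the_inv_into S r j. x $ i else x $ j)" for x
  define W :: "(rat ^ 'n) set" where "W = {x. \<forall>j. j \<notin> - r ` S \<longrightarrow> x $ j = 0}"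
  have f_pivot: "f x $ r I = (\<Sum>i\<in>I. x $ i)" if "I \<in> S" for x I
    using that by (simp add: f_def the_inv_into_f_f[OF inj_r])
  have lin: "Vector_Spaces.linear (*s) (*s) f"
    by (rule Vector_Spaces.linear_iff[THEN iffD2])
      (auto simp: f_def vec_eq_iff sum.distrib sum_distrib_left vec.vector_space_axioms)
  have "x = 0" if "f x = 0" for x
  proof -
    have off_pivot: "x $ j = 0" if "j \<notin> r ` S" for j
      using arg_cong[OF \<open>f x = 0\<close>, of "\<lambda>y. y $ j"] that by (simp add: f_def)
    have pivot: "x $ r I = 0" if "I \<in> S" for I
      using that
    proof (induction "card I" arbitrary: I rule: less_induct)
      case less
      have "x $ j = 0" if j: "j \<in> I - {r I}" for j
      proof (cases "j \<in> r ` S")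
        case True
        then obtain J where J: "J \<in> S" "j = r J" by blast
        with j less.prems have "J \<subset> I"
          using below by blast
        then show ?thesis
          using less.hyps J by (simp add: psubset_card_mono)
      qed (rule off_pivot)
      moreover have "(\<Sum>i\<in>I. x $ i) = x $ r I + (\<Sum>i\<in>I - {r I}. x $ i)"
        using r_in[OF less.prems] by (simp add: sum.remove)
      moreover have "(\<Sum>i\<in>I. x $ i) = 0"
        using f_pivot[OF less.prems, of x] \<open>f x = 0\<close> by simp
      ultimately show ?case by simp
    qed
    have "x $ j = 0" for j
      using off_pivot pivot by (cases "j \<in> r ` S") blast+
    then show "x = 0"
      by (simp add: vec_eq_iff)
  qed
  then have inj: "inj f"
    using vec.linear_inj_iff_eq_0[OF lin] by blast
  then have surj: "surj f"
    using vec.linear_inj_imp_surj[OF lin] by blast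
  \<comment> \<open>In the new coordinates the equations of the hyperplanes say that the pivots vanish.\<close>
  have "(\<Inter>I\<in>S. hyp I) = f -` W"
    by (auto simp: W_def hyp_def f_pivot)
  then have "f ` (\<Inter>I\<in>S. hyp I) = W"
    using surj by (simp add: surj_image_vimage_eq)
  then have "vec.dim (\<Inter>I\<in>S. hyp I) = vec.dim W"
    using vec.dim_image_eq[OF lin inj_on_subset[OF inj subset_UNIV]] by metis
  also have "\<dots> = card (- r ` S)"
    unfolding W_def by (rule dim_substandard_cart)
  finally have dim: "vec.dim (\<Inter>I\<in>S. hyp I) = card (- r ` S)" .
  have "card (- r ` S) + card (r ` S) = CARD('n)"
    by (subst card_Un_disjoint[symmetric]) auto
  then show ?thesis
    using dim card_image[OF inj_r] by simp
qed

theorem lemma3p10: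
  fixes G :: "'n::finite hypergraph" and S :: "'n set set" and k :: nat
  assumes "simple_hypergraph G" and "verts G = UNIV"
    and "nested_set (building_set_of (conn_arrangement G)) S"
    and "card S = k"
  shows "(\<Inter>I\<in>S. hyp I) \<in> intersection_lattice (conn_arrangement G)
    \<and> lattice_rank (\<Inter>I\<in>S. hyp I) = k"
proof
  let ?F = "building_set_of (conn_arrangement G)"
  have laminar: "I \<subseteq> J \<or> J \<subseteq> I \<or> I \<inter> J = {}" if "I \<in> S" "J \<in> S" for I J
    using assms(3) that by (simp add: nested_set_def)
  have "hyp ` S \<subseteq> conn_arrangement G"
    using assms(3) by (auto simp: nested_set_def building_set_of_def)
  then show "(\<Inter>I\<in>S. hyp I) \<in> intersection_lattice (conn_arrangement G)"
    unfolding intersection_lattice_def by blast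
  have "{} \<notin> ?F"
    by (simp add: building_set_of_def)
  then have "\<forall>I\<in>S. \<exists>i. i \<in> I \<and> (\<forall>J\<in>S. J \<subset> I \<longrightarrow> i \<notin> J)"
    using nested_set_private_element[OF assms(3)] by (meson finite)
  then obtain r where r: "\<And>I. I \<in> S \<Longrightarrow> r I \<in> I"
      "\<And>I J. I \<in> S \<Longrightarrow> J \<in> S \<Longrightarrow> J \<subset> I \<Longrightarrow> r I \<notin> J"
    by metis
  show "lattice_rank (\<Inter>I\<in>S. hyp I) = k"
    unfolding lattice_rank_def
    using dim_Inter_hyp_laminar[of S r, OF laminar r] assms(4) by simp
qed

end
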